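(* Let $[a,b]\subset\mathbb{R}$ be an interval and let $k\ge 6$ be an integer. Then $$ m\left([a,b]\cap\bigcup_{k^{n-1}<q\le k^n}\ \bigcup_{p\in\mathbb{Z}} B\!\left(\frac{p}{q},\frac{k}{k^{2n}}\right)\right)\ \ge\ \frac12\,(b-a) $$ for all sufficiently large $n\in\mathbb{N}$ (the union over $q$ ranges over integers $q$).
   Context: $m$ denotes one-dimensional Lebesgue measure on $\mathbb{R}$, and for $x\in\mathbb{R}$, $r>0$, $B(x,r)=(x-r,x+r)$. *)

theory Defs
  imports "HOL-Analysis.Analysis"
begin

end

theory Submission
  imports Defs
begin

text \<open>
  By Dirichlet, every real number lies within \<open>1 / (q N)\<close> of some \<open>p / q\<close> with
  \<open>1 \<le> q \<le> N = k ^ n\<close>. If \<open>q > Q = k ^ (n - 1)\<close>, this distance is below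
  \<open>1 / (Q N) = k / k ^ (2 n)\<close>. Hence the points of \<open>[a, b]\<close> missed by the union are within
  \<open>1 / (q N)\<close> of some \<open>p / q\<close> with \<open>q \<le> Q\<close>. For each \<open>q\<close> at most \<open>q (b - a) + 3\<close> of these
  neighbourhoods meet \<open>[a, b]\<close>, so the missed set has measure at most
  \<open>2 (b - a) Q / N + 6 H / N\<close>, where \<open>H\<close> is the \<open>Q\<close>-th harmonic number. The first term is
  \<open>2 (b - a) / k \<le> (b - a) / 3\<close> and the second one tends to \<open>0\<close>.
\<close>

lemma lim_harm_over_n: "(\<lambda>n. harm n / real n) \<longlonglongrightarrow> 0"
proof -
  have "(\<lambda>n. (harm n - ln (real n)) / real n + ln (real n) / real n) \<longlonglongrightarrow> 0 + 0"
    by (intro tendsto_add lim_ln_over_n tendsto_divide_0[OF euler_mascheroni_LIMSEQ]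
          filterlim_at_top_imp_at_infinity filterlim_real_sequentially)
  then show ?thesis
    by (simp add: add_divide_distrib[symmetric])
qed

lemma int_between_eq_atLeastAtMost:
  fixes u v :: real
  shows "{p :: int. u \<le> p \<and> p \<le> v} = {\<lceil>u\<rceil>..\<lfloor>v\<rfloor>}"
  by (auto simp: ceiling_le_iff le_floor_iff)

lemma card_int_between_le:
  fixes u v :: real
  assumes "u \<le> v"
  shows "real (card {p :: int. u \<le> p \<and> p \<le> v}) \<le> v - u + 1"
  using assms unfolding int_between_eq_atLeastAtMost by simp linarith

definition near_rationals :: "int set \<Rightarrow> (int \<Rightarrow> real) \<Rightarrow> real set" where
  "near_rationals D r = (\<Union>q\<in>D. \<Union>p :: int. ball (of_int p / of_int q) (r q))"

lemma open_near_rationals: "open (near_rationals D r)"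
  by (auto simp: near_rationals_def)

lemma near_rationals_in_sets_lebesgue [simp]: "near_rationals D r \<in> sets lebesgue"
  by (auto intro!: borel_open open_near_rationals)

lemma near_rationals_Un: "near_rationals (D \<union> E) r = near_rationals D r \<union> near_rationals E r"
  by (simp add: near_rationals_def)

lemma near_rationals_mono:
  assumes "D \<subseteq> E" "\<And>q. q \<in> D \<Longrightarrow> r q \<le> s q"
  shows "near_rationals D r \<subseteq> near_rationals E s"
  unfolding near_rationals_def using assms by (intro UN_mono subset_ball) auto

lemma near_rationals_Dirichlet_eq_UNIV:
  fixes N :: nat
  assumes "0 < N"
  shows "near_rationals {1..int N} (\<lambda>q. 1 / (real_of_int q * N)) = UNIV"
proof -
  have "x \<in> near_rationals {1..int N} (\<lambda>q. 1 / (real_of_int q * N))" for x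
  proof -
    obtain p q where q_range: "0 < q" "q \<le> int N"
      and approx: "\<bar>of_int q * x - of_int p\<bar> < 1 / N"
      using Dirichlet_approx[OF assms] by blast
    have "of_int q * x - of_int p = q * (x - p / q)"
      using q_range by (simp add: algebra_simps)
    then have "\<bar>of_int q * x - of_int p\<bar> = q * dist (p / q) x"
      using q_range by (simp add: dist_real_def abs_mult abs_minus_commute)
    then have "x \<in> ball (p / q) (1 / (q * N))"
      using q_range approx \<open>0 < N\<close> by (simp add: field_simps)
    then show ?thesis
      using q_range unfolding near_rationals_def by (intro UN_I[of q] UN_I[of p]) auto
  qed
  then show ?thesis
    by blast
qed

lemma measure_near_rationals_single_denominator_le:
  fixes a b :: real and q :: int and r :: "int \<Rightarrow> real"
  assumes "a \<le> b" "0 < q" "0 \<le> r q"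
  shows "measure lebesgue ({a..b} \<inter> near_rationals {q} r)
    \<le> 2 * r q * (q * (b - a) + 2 * q * r q + 1)"
proof -
  define P where "P = {p :: int. q * (a - r q) \<le> p \<and> p \<le> q * (b + r q)}"
  have "finite P"
    unfolding P_def int_between_eq_atLeastAtMost by simp
  have card_P: "real (card P) \<le> q * (b + r q) - q * (a - r q) + 1"
    unfolding P_def using assms by (intro card_int_between_le mult_left_mono) auto
  have "{a..b} \<inter> near_rationals {q} r \<subseteq> (\<Union>p\<in>P. ball (p / q) (r q))"
  proof
    fix x assume x_in: "x \<in> {a..b} \<inter> near_rationals {q} r"
    then obtain p :: int where x_near: "x \<in> ball (p / q) (r q)"
      unfolding near_rationals_def by blast
    then have "a - r q \<le> p / q" "p / q \<le> b + r q"
      using x_in by (auto simp: dist_real_def abs_less_iff)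
    then have "p \<in> P"
      using \<open>0 < q\<close> by (simp add: P_def pos_le_divide_eq pos_divide_le_eq mult.commute)
    with x_near show "x \<in> (\<Union>p\<in>P. ball (p / q) (r q))"
      by blast
  qed
  then have "measure lebesgue ({a..b} \<inter> near_rationals {q} r)
      \<le> measure lebesgue (\<Union>p\<in>P. ball (p / q) (r q))"
    using \<open>finite P\<close> by (intro measure_mono_fmeasurable fmeasurable.finite_UN) auto
  also have "\<dots> \<le> (\<Sum>p\<in>P. measure lebesgue (ball (of_int p / of_int q :: real) (r q)))"
    using \<open>finite P\<close> by (intro measure_UNION_le) auto
  also have "\<dots> = 2 * r q * card P"
    using assms by (simp add: ball_eq_greaterThanLessThan)
  also have "\<dots> \<le> 2 * r q * (q * (b + r q) - q * (a - r q) + 1)"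
    using card_P assms by (intro mult_left_mono) auto
  finally show ?thesis
    by (simp add: algebra_simps)
qed

lemma measure_near_rationals_le:
  fixes a b :: real and D :: "int set" and r :: "int \<Rightarrow> real"
  assumes "a \<le> b" "finite D" "\<And>q. q \<in> D \<Longrightarrow> 0 < q" "\<And>q. q \<in> D \<Longrightarrow> 0 \<le> r q"
  shows "measure lebesgue ({a..b} \<inter> near_rationals D r)
    \<le> (\<Sum>q\<in>D. 2 * r q * (q * (b - a) + 2 * q * r q + 1))"
proof -
  have "{a..b} \<inter> near_rationals D r = (\<Union>q\<in>D. {a..b} \<inter> near_rationals {q} r)"
    by (auto simp: near_rationals_def)
  also have "measure lebesgue \<dots> \<le> (\<Sum>q\<in>D. measure lebesgue ({a..b} \<inter> near_rationals {q} r))"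
    using \<open>finite D\<close> by (intro measure_UNION_le) auto
  also have "\<dots> \<le> (\<Sum>q\<in>D. 2 * r q * (q * (b - a) + 2 * q * r q + 1))"
    using assms by (intro sum_mono measure_near_rationals_single_denominator_le) auto
  finally show ?thesis .
qed

lemma measure_near_rationals_small_denominators_le:
  fixes a b :: real and Q N :: nat
  assumes "a \<le> b" "0 < N"
  shows "measure lebesgue ({a..b} \<inter> near_rationals {1..int Q} (\<lambda>q. 1 / (real_of_int q * N)))
    \<le> 2 * Q / N * (b - a) + 6 * harm Q / N"
proof -
  let ?r = "\<lambda>q :: int. 1 / (real_of_int q * N)"
  have "measure lebesgue ({a..b} \<inter> near_rationals {1..int Q} ?r)
      \<le> (\<Sum>q = 1..int Q. 2 * ?r q * (q * (b - a) + 2 * q * ?r q + 1))"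
    using measure_near_rationals_le[OF \<open>a \<le> b\<close>, of "{1..int Q}" ?r] by simp
  also have "\<dots> \<le> (\<Sum>q = 1..int Q. 2 / N * (b - a) + 6 / N * inverse q)"
  proof (rule sum_mono)
    fix q assume q_range: "q \<in> {1..int Q}"
    then have "2 * ?r q * (q * (b - a) + 2 * q * ?r q + 1)
        = 2 / N * (b - a) + (4 / N + 2) / N * inverse q"
      using \<open>0 < N\<close> by (simp add: field_simps)
    also have "(4 / N + 2) / N * inverse q \<le> 6 / N * inverse q"
      using \<open>0 < N\<close> q_range by (intro mult_right_mono divide_right_mono) (auto simp: field_simps)
    finally show "2 * ?r q * (q * (b - a) + 2 * q * ?r q + 1)
        \<le> 2 / N * (b - a) + 6 / N * inverse q"
      by simp
  qed
  also have "\<dots> = (\<Sum>q = 1..Q. 2 / N * (b - a) + 6 / N * inverse (real q))"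
    by (simp add: sum.atLeast_int_atMost_int_shift[of _ 1 Q, simplified])
  also have "\<dots> = 2 * Q / N * (b - a) + 6 * harm Q / N"
    by (simp add: sum.distrib harm_def sum_distrib_left divide_inverse mult_ac)
  finally show ?thesis .
qed

lemma near_rationals_small_Un_large_eq_UNIV:
  fixes Q N :: nat
  assumes "0 < Q" "0 < N"
  shows "near_rationals {1..int Q} (\<lambda>q. 1 / (real_of_int q * N)) \<union>
    near_rationals {int Q<..int N} (\<lambda>_. 1 / (real Q * N)) = UNIV"
proof -
  have "near_rationals {1..int N} (\<lambda>q. 1 / (real_of_int q * N))
      \<subseteq> near_rationals ({1..int Q} \<union> {int Q<..int N}) (\<lambda>q. 1 / (real_of_int q * N))"
    by (rule near_rationals_mono) auto
  moreover have "near_rationals {int Q<..int N} (\<lambda>q. 1 / (real_of_int q * N))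
      \<subseteq> near_rationals {int Q<..int N} (\<lambda>_. 1 / (real Q * N))"
  proof (rule near_rationals_mono[OF subset_refl])
    fix q assume "q \<in> {int Q<..int N}"
    then have "real Q \<le> of_int q"
      by simp
    then show "1 / (real_of_int q * N) \<le> 1 / (real Q * N)"
      using assms by (intro divide_left_mono mult_right_mono) auto
  qed
  ultimately show ?thesis
    unfolding near_rationals_Dirichlet_eq_UNIV[OF \<open>0 < N\<close>] near_rationals_Un by blast
qed

lemma measure_near_rationals_large_denominators_ge:
  fixes a b :: real and Q N :: nat
  assumes "a \<le> b" "0 < Q" "0 < N"
  shows "(b - a) - (2 * Q / N * (b - a) + 6 * harm Q / N)
    \<le> measure lebesgue ({a..b} \<inter> near_rationals {int Q<..int N} (\<lambda>_. 1 / (real Q * N)))"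
proof -
  let ?small = "near_rationals {1..int Q} (\<lambda>q. 1 / (real_of_int q * N))"
  let ?large = "near_rationals {int Q<..int N} (\<lambda>_. 1 / (real Q * N))"
  have cover: "({a..b} \<inter> ?small) \<union> ({a..b} \<inter> ?large) = {a..b}"
    using near_rationals_small_Un_large_eq_UNIV[OF assms(2,3)] by blast
  have "measure lebesgue {a..b}
      \<le> measure lebesgue ({a..b} \<inter> ?small) + measure lebesgue ({a..b} \<inter> ?large)"
    by (subst cover[symmetric], intro measure_Un_le) auto
  then show ?thesis
    using measure_near_rationals_small_denominators_le[OF assms(1,3), of Q] \<open>a \<le> b\<close> by simp
qed

lemma eventually_measure_near_rationals_ge:
  fixes a b c :: real and k :: nat
  assumes "a \<le> b" "0 < k" "c < 1 - 2 / k"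
  shows "\<forall>\<^sub>F Q in sequentially. c * (b - a) \<le> measure lebesgue
    ({a..b} \<inter> near_rationals {int Q<..int (k * Q)} (\<lambda>_. 1 / (real Q * real (k * Q))))"
proof (cases "a = b")
  case False
  with assms have "0 < (1 - 2 / k - c) * (b - a)"
    by simp
  moreover have "(\<lambda>Q. 6 / k * (harm Q / Q)) \<longlonglongrightarrow> 6 / k * 0"
    by (intro tendsto_mult_left lim_harm_over_n)
  ultimately have "\<forall>\<^sub>F Q in sequentially. 6 / k * (harm Q / Q) < (1 - 2 / k - c) * (b - a)"
    by (intro order_tendstoD) auto
  then show ?thesis
    using eventually_gt_at_top[of 0]
  proof eventually_elim
    case (elim Q)
    have "c * (b - a) \<le> (b - a) - (2 / k * (b - a) + 6 / k * (harm Q / Q))"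
      using elim(1) by (simp add: algebra_simps)
    also have "\<dots> = (b - a) - (2 * Q / (k * Q) * (b - a) + 6 * harm Q / (k * Q))"
      using elim(2) by simp
    also have "\<dots> \<le> measure lebesgue
        ({a..b} \<inter> near_rationals {int Q<..int (k * Q)} (\<lambda>_. 1 / (real Q * real (k * Q))))"
      using measure_near_rationals_large_denominators_ge[OF \<open>a \<le> b\<close> elim(2), of "k * Q"]
        \<open>0 < k\<close> elim(2) by simp
    finally show ?case .
  qed
qed simp

theorem theorem1p3:
  fixes a b :: real and k :: int
  assumes "a \<le> b" and "k \<ge> 6"
  shows "\<forall>\<^sub>F n :: nat in sequentially.
    measure lebesgue
      ({a..b} \<inter> (\<Union>q :: int \<in> {k ^ (n - 1) <.. k ^ n}. \<Union>p :: int.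
         ball (real_of_int p / real_of_int q) (real_of_int k / real_of_int k ^ (2 * n))))
    \<ge> 1 / 2 * (b - a)"
proof -
  obtain K where k_eq: "k = int K" and "K \<ge> 6"
    using \<open>k \<ge> 6\<close> by (cases k) auto
  define large where
    "large Q = near_rationals {int Q<..int (K * Q)} (\<lambda>_. 1 / (real Q * real (K * Q)))" for Q
  have "\<forall>\<^sub>F Q in sequentially. 1 / 2 * (b - a) \<le> measure lebesgue ({a..b} \<inter> large Q)"
    unfolding large_def using \<open>a \<le> b\<close> \<open>K \<ge> 6\<close>
    by (intro eventually_measure_near_rationals_ge) (auto simp: field_simps)
  moreover have "filterlim (\<lambda>n. K ^ n) sequentially sequentially"
    using \<open>K \<ge> 6\<close> by (intro filterlim_subseq strict_monoI power_strict_increasing) auto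
  ultimately have "\<forall>\<^sub>F n in sequentially.
      1 / 2 * (b - a) \<le> measure lebesgue ({a..b} \<inter> large (K ^ n))"
    by (rule eventually_compose_filterlim)
  moreover have "large (K ^ n) = near_rationals {k ^ n<..k ^ Suc n} (\<lambda>_. k / k ^ (2 * Suc n))" for n
    using \<open>K \<ge> 6\<close>
    by (simp add: large_def k_eq power_mult power_mult_distrib power2_eq_square mult_ac)
  ultimately show ?thesis
    by (subst eventually_sequentially_Suc[symmetric]) (simp add: near_rationals_def)
qed

end
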